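(* Let $G$ be a connected graph on $n$ vertices and $m$ edges with maximum degree $\Delta$, and suppose exactly $k$ vertices have degree $\Delta$, where $k<n$. Then $$\sigma_{t}(G)\geq \frac{k}{n-k}\,(n\Delta-2m)^{2}.$$ Equality holds if and only if the $n-k$ vertices not of maximum degree all have degree $\frac{2m-k\Delta}{n-k}$.
   Context: For a finite simple graph $G$ with $d(v)$ the degree of $v$, $\sigma_{t}(G)=\sum_{\{u,v\}\subseteq V(G)}(d(u)-d(v))^{2}$, summing over all unordered pairs of distinct vertices. *)

theory Defs
  imports Complex_Main "Graph_Theory.Digraph_Component"
begin

text \<open>
  A finite simple graph is a member of the locale \<^locale>\<open>graph\<close>: a finite, loop-free,
  symmetric digraph without parallel arcs. Each undirected edge is thus represented by a
  pair of opposite arcs, so the degree of a vertex is the number of its outgoing arcs, and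
  edges have to be counted as two-element sets of vertices rather than as arcs.
\<close>

abbreviation degree :: "('a, 'b) pre_digraph \<Rightarrow> 'a \<Rightarrow> nat" where
  "degree G v \<equiv> out_degree G v"

definition edges :: "('a, 'b) pre_digraph \<Rightarrow> 'a set set" where
  "edges G = (\<lambda>a. {tail G a, head G a}) ` arcs G"

definition max_degree :: "('a, 'b) pre_digraph \<Rightarrow> nat" where
  "max_degree G = Max (degree G ` verts G)"

text \<open>
  The description operator turns the expression in \<open>u\<close> and \<open>v\<close> into a function of the
  unordered pair \<open>{u, v}\<close>; by \<open>sq_degree_diff_pair\<close> it is well defined.
\<close>

definition sq_degree_diff :: "('a, 'b) pre_digraph \<Rightarrow> 'a set \<Rightarrow> real" where
  "sq_degree_diff G p =
     (THE x. \<exists>u v. p = {u, v} \<and> x = (real (degree G u) - real (degree G v))\<^sup>2)"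

lemma sq_degree_diff_pair:
  "sq_degree_diff G {u, v} = (real (degree G u) - real (degree G v))\<^sup>2"
  unfolding sq_degree_diff_def
  by (rule the_equality) (auto simp: doubleton_eq_iff power2_commute)

definition sigma_t :: "('a, 'b) pre_digraph \<Rightarrow> real" where
  "sigma_t G = (\<Sum>p \<in> {{u, v} |u v. u \<in> verts G \<and> v \<in> verts G \<and> u \<noteq> v}. sq_degree_diff G p)"

end

theory Submission
  imports Defs
begin

text \<open>
  Put \<open>g v = \<Delta> - d v\<close>, which vanishes on the vertices of maximum degree, let \<open>B\<close> be the set of
  the other vertices and let \<open>Q\<close> be the sum of \<open>(g u - g v)\<^sup>2\<close> over the ordered pairs in \<open>B\<close>.
  The identity \<open>\<Sum>\<^sub>u \<Sum>\<^sub>v (g u - g v)\<^sup>2 = 2 |A| \<Sum> g\<^sup>2 - 2 (\<Sum> g)\<^sup>2\<close>, applied to all vertices and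
  to \<open>B\<close>, gives \<open>\<sigma>\<^sub>t = k / (n - k) (\<Sum> g)\<^sup>2 + n / (n - k) Q / 2\<close>, and \<open>\<Sum> g = n \<Delta> - 2 m\<close> by
  the handshake lemma. Equality therefore means \<open>Q = 0\<close>, i.e. that the degree is constant on \<open>B\<close>.
\<close>

text \<open>Symmetry and irreflexivity give every unordered pair in the image exactly two preimages,
  \<open>(u, v)\<close> and \<open>(v, u)\<close>. With \<open>h\<close> constantly 1 this counts
  edges; with \<open>sq_degree_diff G\<close> it rewrites \<open>sigma_t\<close>.\<close>

lemma sum_symmetric_pairs:
  fixes h :: "'a set \<Rightarrow> real"
  assumes "finite R" "sym R" "irrefl R"
  shows "(\<Sum>(u, v)\<in>R. h {u, v}) = 2 * (\<Sum>p\<in>(\<lambda>(u, v). {u, v}) ` R. h p)"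
proof -
  let ?f = "\<lambda>(u, v). {u, v} :: 'a set"
  have "(\<Sum>(u, v)\<in>R. h {u, v}) = (\<Sum>x\<in>R. h (?f x))"
    by (simp add: case_prod_unfold)
  also have "\<dots> = (\<Sum>p\<in>?f ` R. \<Sum>x\<in>{x \<in> R. ?f x = p}. h (?f x))"
    using \<open>finite R\<close> by (rule sum.image_gen)
  also have "\<dots> = (\<Sum>p\<in>?f ` R. 2 * h p)"
  proof (rule sum.cong[OF refl])
    fix p assume "p \<in> ?f ` R"
    then obtain u v where uv: "(u, v) \<in> R" "p = {u, v}" by auto
    with assms have "u \<noteq> v" "(v, u) \<in> R" by (auto simp: irrefl_def dest: symD)
    with uv have "{x \<in> R. ?f x = p} = {(u, v), (v, u)}"
      by (auto simp: doubleton_eq_iff)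
    then show "(\<Sum>x\<in>{x \<in> R. ?f x = p}. h (?f x)) = 2 * h p"
      using uv \<open>u \<noteq> v\<close> by (simp add: insert_commute)
  qed
  finally show ?thesis by (simp add: sum_distrib_left)
qed

lemma sum_sq_diff:
  fixes f :: "'a \<Rightarrow> real"
  shows "(\<Sum>u\<in>A. \<Sum>v\<in>A. (f u - f v)\<^sup>2)
    = 2 * real (card A) * (\<Sum>v\<in>A. (f v)\<^sup>2) - 2 * (\<Sum>v\<in>A. f v)\<^sup>2"
proof -
  have "(\<Sum>u\<in>A. \<Sum>v\<in>A. (f u - f v)\<^sup>2)
    = (\<Sum>u\<in>A. \<Sum>v\<in>A. (f u)\<^sup>2) + (\<Sum>u\<in>A. \<Sum>v\<in>A. (f v)\<^sup>2) - 2 * (\<Sum>u\<in>A. \<Sum>v\<in>A. f u * f v)"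
    by (simp add: power2_diff sum.distrib sum_subtractf sum_distrib_left mult.assoc)
  also have "(\<Sum>u\<in>A. \<Sum>v\<in>A. f u * f v) = (\<Sum>v\<in>A. f v)\<^sup>2"
    by (simp add: power2_eq_square sum_product)
  finally show ?thesis
    by (simp add: sum_distrib_left[symmetric])
qed

lemma sum_sq_diff_eq_0_iff:
  fixes f :: "'a \<Rightarrow> real"
  assumes "finite A"
  shows "(\<Sum>u\<in>A. \<Sum>v\<in>A. (f u - f v)\<^sup>2) = 0 \<longleftrightarrow> (\<forall>u\<in>A. \<forall>v\<in>A. f u = f v)"
  using assms by (simp add: sum_nonneg_eq_0_iff sum_nonneg)

text \<open>Turns the condition that the degree is constant on \<open>B\<close> into the explicit
  value in the equality case.\<close>

lemma constant_on_iff_eq_mean: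
  fixes f :: "'a \<Rightarrow> real"
  assumes "finite A"
  shows "(\<forall>u\<in>A. \<forall>v\<in>A. f u = f v) \<longleftrightarrow> (\<forall>v\<in>A. f v = (\<Sum>u\<in>A. f u) / real (card A))"
proof
  assume c: "\<forall>u\<in>A. \<forall>v\<in>A. f u = f v"
  show "\<forall>v\<in>A. f v = (\<Sum>u\<in>A. f u) / real (card A)"
  proof
    fix v assume "v \<in> A"
    then have "(\<Sum>u\<in>A. f u) = (\<Sum>u\<in>A. f v)"
      using c by (blast intro: sum.cong)
    \<comment> \<open>The sum is \<open>card A\<close> times \<open>f v\<close>, and
      \<open>card A\<close> is nonzero because \<open>v\<close> lies in the finite set
      \<open>A\<close>.\<close>
    then show "f v = (\<Sum>u\<in>A. f u) / real (card A)"
      using \<open>v \<in> A\<close> assms by auto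
  qed
qed metis

text \<open>The out-arc sets partition the arcs. Without parallel arcs, arcs correspond to their
  ordered pairs of ends, and these form a symmetric, irreflexive relation that covers each edge
  twice.\<close>

lemma (in graph) sum_out_degree_eq_twice_edges:
  "(\<Sum>v\<in>verts G. real (out_degree G v)) = 2 * real (card (edges G))"
proof -
  have "(\<Sum>v\<in>verts G. out_degree G v) = card (\<Union>v\<in>verts G. out_arcs G v)"
    unfolding out_degree_def
    by (rule card_UN_disjoint[symmetric]) (auto simp: finite_out_arcs)
  also have "(\<Union>v\<in>verts G. out_arcs G v) = arcs G"
    by auto
  also have "card (arcs G) = card (arcs_ends G)"
    unfolding arcs_ends_def
    by (rule card_image[symmetric])
      (auto simp: inj_on_def arc_to_ends_def intro: no_multi_arcs)
  finally have sum: "(\<Sum>v\<in>verts G. out_degree G v) = card (arcs_ends G)" .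
  have "edges G = (\<lambda>(u, v). {u, v}) ` arcs_ends G"
    by (auto simp: edges_def arcs_ends_def arc_to_ends_def image_image)
  moreover have "irrefl (arcs_ends G)"
    using no_loops by (auto simp: irrefl_def arcs_ends_def arc_to_ends_def)
  moreover have "sym (arcs_ends G)"
    using sym_arcs by (simp add: symmetric_def)
  moreover have "finite (arcs_ends G)"
    by (simp add: arcs_ends_def)
  ultimately have "real (card (arcs_ends G)) = 2 * real (card (edges G))"
    using sum_symmetric_pairs[of "arcs_ends G" "\<lambda>_. 1"] by simp
  with sum show ?thesis
    by (metis of_nat_sum)
qed

lemma sigma_t_eq_sum_sq_diff:
  assumes "finite (verts G)"
  shows "2 * sigma_t G
    = (\<Sum>u\<in>verts G. \<Sum>v\<in>verts G. (real (degree G u) - real (degree G v))\<^sup>2)"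
proof -
  let ?R = "verts G \<times> verts G - Id"
  let ?h = "\<lambda>(u, v). (real (degree G u) - real (degree G v))\<^sup>2"
  have "{{u, v} |u v. u \<in> verts G \<and> v \<in> verts G \<and> u \<noteq> v} = (\<lambda>(u, v). {u, v}) ` ?R"
    by (auto simp: image_def)
  then have "2 * sigma_t G = (\<Sum>(u, v)\<in>?R. sq_degree_diff G {u, v})"
    unfolding sigma_t_def using assms
    by (subst sum_symmetric_pairs) (auto simp: irrefl_def sym_def)
  also have "\<dots> = (\<Sum>x\<in>?R. ?h x)"
    by (simp add: sq_degree_diff_pair)
  \<comment> \<open>The added diagonal pairs contribute zero.\<close>
  also have "\<dots> = (\<Sum>x\<in>verts G \<times> verts G. ?h x)"
    using assms by (intro sum.mono_neutral_left) auto
  also have "\<dots> = (\<Sum>u\<in>verts G. \<Sum>v\<in>verts G. (real (degree G u) - real (degree G v))\<^sup>2)"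
    by (simp add: sum.cartesian_product)
  finally show ?thesis .
qed

theorem theorem14:
  fixes G :: "('a, 'b) pre_digraph" and n m \<Delta> k :: nat
  assumes "graph G"
    and "Digraph_Component.connected G"
    and "n = card (verts G)"
    and "m = card (edges G)"
    and "\<Delta> = max_degree G"
    and "k = card {v \<in> verts G. degree G v = \<Delta>}"
    and "k < n"
  shows "sigma_t G \<ge> real k / (real n - real k) * (real n * real \<Delta> - 2 * real m)\<^sup>2 \<and>
    (sigma_t G = real k / (real n - real k) * (real n * real \<Delta> - 2 * real m)\<^sup>2 \<longleftrightarrow>
       (\<forall>v \<in> verts G. degree G v \<noteq> \<Delta> \<longrightarrow>
            real (degree G v) = (2 * real m - real k * real \<Delta>) / (real n - real k)))"
proof -
  interpret graph G by fact
  define B where "B = {v \<in> verts G. degree G v \<noteq> \<Delta>}"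
  define g where "g v = real \<Delta> - real (degree G v)" for v
  define T where "T = real n * real \<Delta> - 2 * real m"
  define S where "S = (\<Sum>v\<in>B. (g v)\<^sup>2)"
  define Q where "Q = (\<Sum>u\<in>B. \<Sum>v\<in>B. (g u - g v)\<^sup>2)"
  let ?V = "verts G" and ?A = "{v \<in> verts G. degree G v = \<Delta>}"
  have fin: "finite B" and split: "?V = ?A \<union> B" "?A \<inter> B = {}"
    by (auto simp: B_def)
  have "n = k + card B"
    using card_Un_disjoint[of ?A B] fin split assms(3,6) by simp
  then have cardB: "real (card B) = real n - real k" by simp
  have pos: "real n - real k > 0" using \<open>k < n\<close> by simp
  \<comment> \<open>Stated for general \<open>h\<close> to cover both the sum of \<open>g\<close>
    and the sum of its squares.\<close>
  have restrict: "(\<Sum>v\<in>?V. h (g v)) = (\<Sum>v\<in>B. h (g v))" if "h 0 = 0" for h :: "real \<Rightarrow> real"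
    using that by (intro sum.mono_neutral_right) (auto simp: B_def g_def)
  have "(\<Sum>v\<in>?V. g v) = T"
    using assms(3,4) by (simp add: g_def T_def sum_subtractf sum_out_degree_eq_twice_edges)
  then have T: "(\<Sum>v\<in>B. g v) = T"
    using restrict[of "\<lambda>x. x"] by simp
  \<comment> \<open>\<open>\<Delta>\<close> cancels in \<open>g u - g v\<close>, leaving the degree
    difference up to sign.\<close>
  have "2 * sigma_t G = (\<Sum>u\<in>?V. \<Sum>v\<in>?V. (g u - g v)\<^sup>2)"
    by (simp add: sigma_t_eq_sum_sq_diff g_def power2_commute)
  then have sigma: "sigma_t G = real n * S - T\<^sup>2"
    using restrict[of "\<lambda>x. x\<^sup>2"] \<open>(\<Sum>v\<in>?V. g v) = T\<close> assms(3)
    by (simp add: sum_sq_diff S_def)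
  have "Q = 2 * (real n - real k) * S - 2 * T\<^sup>2"
    by (simp add: Q_def sum_sq_diff S_def T cardB)
  then have dS: "(real n - real k) * S = Q / 2 + T\<^sup>2"
    by (simp add: field_simps)
  \<comment> \<open>Scaling by \<open>n - k\<close> lets \<open>dS\<close> eliminate
    \<open>S\<close>; the coefficient of \<open>T\<^sup>2\<close> becomes n - (n - k) = k.\<close>
  have "(real n - real k) * sigma_t G = real n * ((real n - real k) * S) - (real n - real k) * T\<^sup>2"
    by (simp add: sigma algebra_simps)
  also have "\<dots> = real k * T\<^sup>2 + real n * (Q / 2)"
    unfolding dS by (simp add: algebra_simps)
  finally have "sigma_t G = (real k * T\<^sup>2 + real n * (Q / 2)) / (real n - real k)"
    using pos by (simp add: eq_divide_eq mult.commute)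
  then have eq: "sigma_t G
      = real k / (real n - real k) * T\<^sup>2 + real n / (real n - real k) * (Q / 2)"
    by (simp add: add_divide_distrib)
  have "Q \<ge> 0"
    by (simp add: Q_def sum_nonneg)
  have "(\<Sum>v\<in>B. real (degree G v)) = 2 * real m - real k * real \<Delta>"
    using T by (simp add: g_def sum_subtractf T_def cardB algebra_simps)
  then have mean: "(\<Sum>v\<in>B. real (degree G v)) / real (card B)
      = (2 * real m - real k * real \<Delta>) / (real n - real k)"
    by (simp only: cardB)
  have "Q = 0 \<longleftrightarrow> (\<forall>u\<in>B. \<forall>v\<in>B. real (degree G u) = real (degree G v))"
    unfolding Q_def sum_sq_diff_eq_0_iff[OF fin] by (simp add: g_def)
  also have "\<dots> \<longleftrightarrow>
      (\<forall>v\<in>B. real (degree G v) = (2 * real m - real k * real \<Delta>) / (real n - real k))"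
    unfolding constant_on_iff_eq_mean[OF fin] mean ..
  finally have "Q = 0 \<longleftrightarrow>
      (\<forall>v\<in>B. real (degree G v) = (2 * real m - real k * real \<Delta>) / (real n - real k))" .
  moreover have "sigma_t G = real k / (real n - real k) * T\<^sup>2 \<longleftrightarrow> Q = 0"
    \<comment> \<open>From k < n also n > 0, so \<open>Q\<close> enters \<open>eq\<close> with a
      strictly positive coefficient.\<close>
    using pos eq \<open>k < n\<close> by simp
  moreover have "sigma_t G \<ge> real k / (real n - real k) * T\<^sup>2"
    using pos eq \<open>Q \<ge> 0\<close> by simp
  ultimately show ?thesis
    unfolding T_def B_def by auto
qed

end
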